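(* Let $0<\alpha<1$, let $d,\beta\in\mathbb{R}$, let $f(t)=(t-d)^{\beta}$, and let $\Omega\subset\mathbb{R}$ be an interval on which $f$ is properly defined as a real-valued function. Below, the lower limit of integration and the point $t$ are always taken in $\Omega$. (I) If $a\in\Omega$ and $\epsilon=|d-a|>0$, then $$\left[{}_{a}J_{t}^{\alpha}(x-d)^{\beta}\right](t)=\sum_{k=0}^{\infty}\frac{\Gamma(\beta+1)\,(a-d)^{\beta-k}\,(t-a)^{\alpha+k}}{\Gamma(\beta-k+1)\,\Gamma(\alpha+k+1)},\qquad t\in\left[a,a+\tfrac{\epsilon}{2}\right).$$ (II) If the lower limit is a point $d^{+}=d+\epsilon$ with $\epsilon>0$, then $$\left[{}_{d^{+}}J_{t}^{\alpha}(x-d)^{\beta}\right](t)=\sum_{k=0}^{\infty}\frac{\Gamma(\beta+1)\,\epsilon^{\beta-k}\,(t-d^{+})^{\alpha+k}}{\Gamma(\beta-k+1)\,\Gamma(\alpha+k+1)},\qquad t\in\left[d^{+},d^{+}+\epsilon\right).$$ Particularly, if $\beta=m\in\mathbb{N}_0$, then for all $a,t\in\mathbb{R}$ with $t\ge a$, $$\left[{}_{a}J_{t}^{\alpha}(x-d)^{m}\right](t)=\sum_{k=0}^{m}\frac{\Gamma(m+1)\,(a-d)^{m-k}\,(t-a)^{\alpha+k}}{\Gamma(m-k+1)\,\Gamma(\alpha+k+1)}.$$ If $\beta=-m$ with $m\in\mathbb{N}$, then also $$\left[{}_{a}J_{t}^{\alpha}(x-d)^{-m}\right](t)=\sum_{k=0}^{\infty}\frac{(-1)^{k}\,\Gamma(m+k)\,(a-d)^{-(m+k)}\,(t-a)^{\alpha+k}}{\Gamma(m)\,\Gamma(\alpha+k+1)},\qquad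 t\in\left[a,a+\tfrac{\epsilon}{2}\right),$$ where $\epsilon=|d-a|>0$, and $$\left[{}_{d^{+}}J_{t}^{\alpha}(x-d)^{-m}\right](t)=\sum_{k=0}^{\infty}\frac{(-1)^{k}\,\Gamma(m+k)\,\epsilon^{-(m+k)}\,(t-d^{+})^{\alpha+k}}{\Gamma(m)\,\Gamma(\alpha+k+1)},\qquad t\in\left[d^{+},d^{+}+\epsilon\right),$$ where $d^{+}=d+\epsilon$, $\epsilon>0$.
   Context: $\mathbb{N}=\{1,2,\dots\}$ and $\mathbb{N}_0=\mathbb{N}\cup\{0\}$. Riemann-Liouville fractional integral (left-sided) of order $\alpha>0$ with lower limit $a$: for $t\ge a$ and $g$ integrable on $[a,t]$, $$[{}_{a}J_{t}^{\alpha}g(x)](t)=\frac{1}{\Gamma(\alpha)}\int_a^t (t-x)^{\alpha-1}g(x)\,dx .$$ Real domain of $f(t)=(t-d)^{\beta}$ ("properly defined as a real-valued function" means $\Omega$ is contained in this domain): $\mathbb{R}$ if $\beta\in\mathbb{N}_0$; $\mathbb{R}\setminus\{d\}$ if $\beta$ is a negative integer; if $\beta=p/q$ is a non-integer rational in lowest terms with $q\in\mathbb{N}$, $(t-d)^{\beta}=\sqrt[q]{(t-d)^{p}}$ and the domain is $\mathbb{R}$ if $p$ is an even positive integer, $[d,\infty)$ if $p$ is an odd positive integer, and $(d,\infty)$ if $p$ is negative; if $\beta$ is irrational, $(t-d)^{\beta}=e^{\beta\ln(t-d)}$ with domain $(d,\infty)$. When $a<d$ and $\beta=p/q$ with $p$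 even and positive (so $q$ is odd), $(a-d)^{\beta-k}=\sqrt[q]{a-d}^{\,p-kq}$ with the real $q$-th root. Gamma function conventions: $\Gamma$ is the analytically continued gamma function; $1/\Gamma(-n)=0$ for $n\in\mathbb{N}_0$ when it is not paired with an infinite numerator; ratios at non-positive integers are interpreted by $\frac{\Gamma(-n)}{\Gamma(-m)}=(-1)^{m-n}\frac{m!}{n!}$ for $m,n\in\mathbb{N}_0$. Thus in all cases $\frac{\Gamma(\beta+1)}{\Gamma(\beta-k+1)}=\beta(\beta-1)\cdots(\beta-k+1)$ (equal to $1$ for $k=0$). The convention $0^0=1$ is used. *)

theory Defs
  imports "HOL-Analysis.Analysis"
begin

section \<open>Real powers with arbitrary real exponent\<close>

definition lowest_terms :: "real \<Rightarrow> int \<times> nat" where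
  "lowest_terms \<beta> = (THE (p, q). q > 0 \<and> coprime p (int q) \<and> \<beta> = of_int p / of_nat q)"

text \<open>
  On negative reals and odd \<open>q\<close> the library function \<^term>\<open>root q\<close> is the real \<open>q\<close>-th root.
  Values outside the real domain of the power function (see \<open>power_domain\<close> below) are irrelevant,
  except that for \<open>\<beta> = p/q\<close> with \<open>p\<close> even and positive, the powers \<open>x\<close> to the \<open>\<beta> - k\<close> with
  \<open>x < 0\<close> and \<open>k\<close> a natural number are needed;
  these are determined by \<open>rpow_diff_of_nat\<close> below.
\<close>

definition rpow :: "real \<Rightarrow> real \<Rightarrow> real" where
  "rpow x \<beta> =
     (if \<beta> \<in> \<int> then x powi \<lfloor>\<beta>\<rfloor>
      else if \<beta> \<in> \<rat> then (case lowest_terms \<beta> of (p, q) \<Rightarrow> root q (x powi p))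
      else exp (\<beta> * ln x))"

text \<open>The real domain of the function \<open>\<lambda>t. rpow (t - d) \<beta>\<close>.\<close>

definition power_domain :: "real \<Rightarrow> real \<Rightarrow> real set" where
  "power_domain d \<beta> =
     (if \<beta> \<in> \<int> then (if \<beta> \<ge> 0 then UNIV else UNIV - {d})
      else if \<beta> \<in> \<rat> then
        (case lowest_terms \<beta> of (p, q) \<Rightarrow>
           if p < 0 then {d<..} else if even p then UNIV else {d..})
      else {d<..})"

lemma lowest_terms_eqI:
  assumes "q > 0" "coprime p (int q)" "\<beta> = of_int p / of_nat q"
  shows "lowest_terms \<beta> = (p, q)"
proof -
  have "(p', q') = (p, q)"
    if "q' > 0" "coprime p' (int q')" "\<beta> = of_int p' / of_nat q'" for p' q'
  proof -
    have "real_of_int (p' * int q) = real_of_int (p * int q')"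
      using assms that by (simp add: field_simps)
    hence eq: "p' * int q = p * int q'"
      by (simp only: of_int_eq_iff)
    have "int q dvd p * int q'" "int q' dvd p' * int q"
      using eq by (metis dvd_triv_right)+
    hence "int q dvd int q'" "int q' dvd int q"
      using assms(2) that(2) by (simp_all add: coprime_commute coprime_dvd_mult_right_iff)
    hence "q = q'"
      by (simp add: dvd_antisym)
    thus ?thesis using eq assms(1) by simp
  qed
  thus ?thesis
    unfolding lowest_terms_def using assms by (intro the_equality) auto
qed

lemma rpow_of_nat: "rpow x (of_nat m) = x ^ m"
  by (simp add: rpow_def)

lemma rpow_of_int: "rpow x (of_int m) = x powi m"
  by (simp add: rpow_def)

lemma rpow_pos:
  assumes "x > 0"
  shows "rpow x \<beta> = x powr \<beta>"
proof (cases "\<beta> \<in> \<int>")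
  case True
  thus ?thesis using assms by (auto simp: rpow_def powr_real_of_int' elim!: Ints_cases)
next
  case nint: False
  show ?thesis
  proof (cases "\<beta> \<in> \<rat>")
    case True
    then obtain r where r: "\<beta> = of_rat r" by (elim Rats_cases)
    obtain p q where pq: "quotient_of r = (p, q)" by force
    have q: "q > 0" "coprime p q" "r = of_int p / of_int q"
      using pq quotient_of_denom_pos quotient_of_coprime quotient_of_div by blast+
    have \<beta>: "\<beta> = of_int p / of_nat (nat q)"
      using q r by (simp add: of_rat_divide)
    have "lowest_terms \<beta> = (p, nat q)"
      using q \<beta> by (intro lowest_terms_eqI) auto
    moreover have "root (nat q) (x powi p) = x powr \<beta>"
      using assms q \<beta> by (simp add: root_powr_inverse powr_powr flip: powr_real_of_int')
    ultimately show ?thesis using nint True by (simp add: rpow_def)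
  next
    case False
    thus ?thesis using nint assms by (simp add: rpow_def powr_def)
  qed
qed

lemma rpow_diff_of_nat:
  assumes "q > 0" "coprime p (int q)" "\<beta> = of_int p / of_nat q" "\<beta> \<notin> \<int>"
  shows "rpow x (\<beta> - of_nat k) = root q x powi (p - int k * int q)"
proof -
  have nint: "\<beta> - of_nat k \<notin> \<int>"
    using assms(4) by (metis Ints_add Ints_of_nat diff_add_cancel)
  have eq: "\<beta> - of_nat k = of_int (p - int k * int q) / of_nat q"
    using assms by (simp add: field_simps)
  have cop: "coprime (p - int k * int q) (int q)"
    using assms(2) by (metis coprime_iff_gcd_eq_1 gcd.commute gcd_diff2 gcd_add_mult
        gcd_add_mult diff_conv_add_uminus mult_minus_left add.commute)
  have "lowest_terms (\<beta> - of_nat k) = (p - int k * int q, q)"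
    by (rule lowest_terms_eqI[OF assms(1) cop eq])
  moreover have "\<beta> - of_nat k \<in> \<rat>"
    unfolding eq by simp
  moreover have "root q (x powi j) = root q x powi j" for j
    using assms(1) by (simp add: power_int_def real_root_power real_root_inverse)
  ultimately show ?thesis
    using nint by (simp add: rpow_def)
qed

section \<open>Ratios of Gamma values\<close>

text \<open>
  The quotient of Gamma values at \<open>x\<close> and \<open>y\<close>.
  If both are poles, say \<open>x = -n\<close> and \<open>y = -m\<close>,
  the value is \<open>(-1)^(m - n) * m! / n!\<close>; if only \<open>y\<close> is a pole, it is \<open>0\<close>.
\<close>

definition Gamma_ratio :: "real \<Rightarrow> real \<Rightarrow> real" where
  "Gamma_ratio x y =
     (if x \<in> \<int>\<^sub>\<le>\<^sub>0 \<and> y \<in> \<int>\<^sub>\<le>\<^sub>0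
      then (-1) powi (\<lfloor>x\<rfloor> - \<lfloor>y\<rfloor>) * fact (nat (- \<lfloor>y\<rfloor>)) / fact (nat (- \<lfloor>x\<rfloor>))
      else Gamma x * rGamma y)"

lemma Gamma_ratio_eq_prod: "Gamma_ratio (\<beta> + 1) (\<beta> - of_nat k + 1) = (\<Prod>i<k. \<beta> - of_nat i)"
proof (cases "\<beta> + 1 \<in> \<int>\<^sub>\<le>\<^sub>0")
  case False
  have "rGamma (\<beta> - of_nat k + 1) = (\<Prod>i<k. \<beta> - of_nat i) * rGamma (\<beta> + 1)"
  proof (induction k)
    case (Suc k)
    have "rGamma (\<beta> - of_nat (Suc k) + 1) = (\<beta> - of_nat k) * rGamma (\<beta> - of_nat k + 1)"
      by (subst rGamma_plus1) simp
    thus ?case using Suc by (simp add: mult_ac)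
  qed simp
  thus ?thesis using False
    by (simp add: Gamma_ratio_def rGamma_inverse_Gamma Gamma_eq_zero_iff)
next
  case True
  then obtain n where "\<beta> + 1 = - of_nat n" by (elim nonpos_Ints_cases')
  hence \<beta>: "\<beta> = - of_nat n - 1" by simp
  have y: "\<beta> - of_nat k + 1 = of_int (- int (n + k))" "\<beta> + 1 = of_int (- int n)"
    using \<beta> by simp_all
  have "(\<Prod>i<k. \<beta> - of_nat i) = (-1) ^ k * fact (n + k) / fact n"
  proof (induction k)
    case (Suc k)
    have "(\<Prod>i<Suc k. \<beta> - of_nat i) = (-1) ^ k * fact (n + k) / fact n * (\<beta> - of_nat k)"
      using Suc by simp
    also have "\<beta> - of_nat k = - (1 + of_nat (n + k))"
      using \<beta> by simp
    finally show ?case by (simp add: field_simps)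
  qed simp
  moreover have "real_of_int (- int n) \<in> \<int>\<^sub>\<le>\<^sub>0" "real_of_int (- int (n + k)) \<in> \<int>\<^sub>\<le>\<^sub>0"
    by (intro nonpos_Ints_of_int; simp)+
  moreover have "- int n - - int (n + k) = int k"
    by simp
  ultimately show ?thesis
    unfolding y Gamma_ratio_def floor_of_int minus_minus nat_int
    by (simp only: simp_thms if_True power_int_of_nat)
qed

section \<open>The left-sided Riemann--Liouville fractional integral\<close>

text \<open>
  \<open>RL_integrable\<close> says that \<open>RL_integral\<close> is a genuine integral; the library
  assigns the value \<open>0\<close> to the Lebesgue integral of a non-integrable function.
\<close>

definition RL_integrable :: "real \<Rightarrow> real \<Rightarrow> (real \<Rightarrow> real) \<Rightarrow> real \<Rightarrow> bool" where
  "RL_integrable a \<alpha> g t \<longleftrightarrow>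
     set_integrable lebesgue {a..t} g \<and>
     set_integrable lebesgue {a..t} (\<lambda>x. (t - x) powr (\<alpha> - 1) * g x)"

definition RL_integral :: "real \<Rightarrow> real \<Rightarrow> (real \<Rightarrow> real) \<Rightarrow> real \<Rightarrow> real" where
  "RL_integral a \<alpha> g t =
     1 / Gamma \<alpha> * (LINT x:{a..t}|lebesgue. (t - x) powr (\<alpha> - 1) * g x)"

end

theory Submission
  imports Defs
begin

text \<open>
  Around a point \<open>a \<noteq> d\<close> of its domain the function \<open>x \<mapsto> (x - d)\<^sup>\<beta>\<close> is the sum of its binomial series
  \<open>\<Sum>k. (\<beta> gchoose k) (a - d)\<^bsup>\<beta> - k\<^esup> (x - a)\<^bsup>k\<^esup>\<close>, which converges absolutely for
  \<open>\<bar>x - a\<bar> < \<bar>a - d\<bar>\<close>. The Riemann--Liouville integral may be taken term by term, and on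
  \<open>(x - a)\<^bsup>k\<^esup>\<close> it is a Beta integral with value
  \<open>k! (t - a)\<^bsup>\<alpha> + k\<^esup> / \<Gamma>(\<alpha> + k + 1)\<close>. The factor \<open>k!\<close> turns the binomial coefficient into
  \<open>\<beta> (\<beta> - 1) \<cdots> (\<beta> - k + 1)\<close>, the quotient of Gamma values in the theorem.

  Termwise integration (\<open>weighted_power_series_integral\<close>) rests on dominated convergence: on
  \<open>[a, t]\<close> the series is dominated by its absolute values at the right end point, and the kernel
  \<open>(t - x)\<^bsup>\<alpha> - 1\<^esup>\<close> is integrable because \<open>\<alpha> > 0\<close>. The computation of the terms is
  \<open>RL_kernel_monomial_integral\<close>, and the two are combined in \<open>RL_power_series\<close>.

  The binomial series (\<open>rpow_binomial_series\<close>) comes from the factorisation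
  \<open>x - d = (a - d) (1 + (x - a) / (a - d))\<close>, in which the second factor is positive. The real power
  is multiplicative with respect to a positive factor, also when \<open>a < d\<close>, so that only the classical
  series of \<open>(1 + z)\<^sup>\<beta>\<close> with \<open>\<bar>z\<bar> < 1\<close> is involved.

  This covers all \<open>t\<close> with \<open>a \<le> t < a + \<bar>a - d\<bar>\<close>, hence both the half-length interval of the
  first part and the interval of the second part, where \<open>a - d = \<epsilon>\<close>. For \<open>\<beta> = m\<close> a natural number
  the expansion is finite and holds for every \<open>x\<close>, so that \<open>a\<close> and \<open>t\<close> are unrestricted. For
  \<open>\<beta> = -m\<close> the quotient of Gamma values becomes \<open>(-1)\<^bsup>k\<^esup> \<Gamma>(m + k) / \<Gamma>(m)\<close>.
\<close>

section \<open>Fractional integration of power series\<close>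

lemma weighted_monomial_integrable:
  fixes w :: "real \<Rightarrow> real"
  assumes "set_integrable lebesgue {a..t} w"
  shows "set_integrable lebesgue {a..t} (\<lambda>x. w x * (x - a) ^ k)"
proof -
  have w: "integrable lebesgue (\<lambda>x. indicator {a..t} x * w x)"
    using assms by (simp add: set_integrable_def)
  have "integrable lebesgue (\<lambda>x. (indicator {a..t} x * w x) * (x - a) ^ k)"
  proof (rule Bochner_Integration.integrable_bound[OF integrable_mult_right[OF w, of "(t - a) ^ k"]])
    have "(\<lambda>x. (x - a) ^ k) \<in> borel_measurable lebesgue"
      by (intro measurable_completion) measurable
    with borel_measurable_integrable[OF w]
    show "(\<lambda>x. (indicator {a..t} x * w x) * (x - a) ^ k) \<in> borel_measurable lebesgue"
      by (rule borel_measurable_times)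
    have "norm (indicator {a..t} x * w x * (x - a) ^ k)
            \<le> norm ((t - a) ^ k * (indicator {a..t} x * w x))" for x
      by (auto simp: indicator_def abs_mult power_abs mult.commute
               intro!: mult_left_mono power_mono)
    thus "AE x in lebesgue. norm (indicator {a..t} x * w x * (x - a) ^ k)
            \<le> norm ((t - a) ^ k * (indicator {a..t} x * w x))"
      by simp
  qed
  thus ?thesis
    by (simp add: set_integrable_def mult.assoc)
qed

text \<open>
  The weight is arbitrary because two instances matter: the kernel \<open>(t - x)\<^bsup>\<alpha> - 1\<^esup>\<close> gives the
  fractional integral, and the constant \<open>1\<close> gives the integrability of \<open>g\<close> itself. The bound
  \<open>\<bar>c k\<bar> (t - a)\<^bsup>k\<^esup> \<bar>w x\<bar>\<close> of the \<open>k\<close>-th term has a summable integral, which permits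
  interchanging sum and integral.
\<close>

lemma weighted_power_series_integral:
  fixes w g :: "real \<Rightarrow> real" and c :: "nat \<Rightarrow> real"
  assumes w: "set_integrable lebesgue {a..t} w"
    and c: "summable (\<lambda>k. \<bar>c k\<bar> * (t - a) ^ k)"
    and g: "\<And>x. x \<in> {a..t} \<Longrightarrow> (\<lambda>k. c k * (x - a) ^ k) sums g x"
  shows "set_integrable lebesgue {a..t} (\<lambda>x. w x * g x)"
    and "(\<lambda>k. c k * (LINT x:{a..t}|lebesgue. w x * (x - a) ^ k))
           sums (LINT x:{a..t}|lebesgue. w x * g x)"
proof -
  define f where "f k x = indicator {a..t} x * (w x * (c k * (x - a) ^ k))" for k x
  have f_eq: "f k x = c k * (indicator {a..t} x *\<^sub>R (w x * (x - a) ^ k))" for k x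
    by (simp add: f_def)
  have f_int: "integrable lebesgue (f k)" for k
    using weighted_monomial_integrable[OF w, of k]
    unfolding f_eq[abs_def] set_integrable_def by (rule integrable_mult_right)
  have w_abs: "integrable lebesgue (\<lambda>x. norm (indicator {a..t} x * w x))"
    using w by (intro integrable_norm) (simp add: set_integrable_def)
  have f_bound: "norm (f k x) \<le> \<bar>c k\<bar> * (t - a) ^ k * norm (indicator {a..t} x * w x)" for k x
  proof (cases "x \<in> {a..t}")
    case True
    hence "\<bar>x - a\<bar> ^ k \<le> (t - a) ^ k"
      by (intro power_mono) auto
    hence "\<bar>c k\<bar> * \<bar>w x\<bar> * \<bar>x - a\<bar> ^ k \<le> \<bar>c k\<bar> * \<bar>w x\<bar> * (t - a) ^ k"
      by (intro mult_left_mono) auto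
    with True show ?thesis
      by (simp add: f_def abs_mult power_abs mult_ac)
  qed (simp add: f_def)
  have "summable (\<lambda>k. norm (f k x))" for x
    using f_bound by (intro summable_comparison_test[OF _ summable_mult2[OF c]]) auto
  hence ae: "AE x in lebesgue. summable (\<lambda>k. norm (f k x))"
    by simp
  have "(\<integral>x. norm (f k x) \<partial>lebesgue)
          \<le> (\<integral>x. \<bar>c k\<bar> * (t - a) ^ k * norm (indicator {a..t} x * w x) \<partial>lebesgue)" for k
    by (intro integral_mono f_bound integrable_norm f_int integrable_mult_right w_abs)
  hence summ: "summable (\<lambda>k. \<integral>x. norm (f k x) \<partial>lebesgue)"
    by (intro summable_comparison_test[OF _ summable_mult2[OF c]]) auto
  have suminf_f: "(\<Sum>k. f k x) = indicator {a..t} x *\<^sub>R (w x * g x)" for x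
  proof (cases "x \<in> {a..t}")
    case True
    thus ?thesis
      using sums_mult[OF g[OF True], of "w x"] by (simp add: f_def sums_iff)
  qed (simp add: f_def)
  show "set_integrable lebesgue {a..t} (\<lambda>x. w x * g x)"
    using integrable_suminf[OF f_int ae summ] by (simp add: suminf_f set_integrable_def)
  show "(\<lambda>k. c k * (LINT x:{a..t}|lebesgue. w x * (x - a) ^ k))
           sums (LINT x:{a..t}|lebesgue. w x * g x)"
    using sums_integral[OF f_int ae summ]
    unfolding suminf_f unfolding f_eq integral_mult_right_zero set_lebesgue_integral_def .
qed

text \<open>
  The substitution \<open>x = a + (t - a) u\<close> transforms this into the Beta integral with parameters
  \<open>k + 1\<close> and \<open>\<alpha>\<close>.
\<close>

lemma RL_kernel_monomial_integral:
  fixes \<alpha> a t :: real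
  assumes "0 < \<alpha>" "a \<le> t"
  shows "((\<lambda>x. (t - x) powr (\<alpha> - 1) * (x - a) ^ k) has_integral
            Gamma \<alpha> * fact k / Gamma (\<alpha> + of_nat k + 1) * (t - a) powr (\<alpha> + of_nat k)) {a..t}"
proof (cases "a = t")
  case True
  have "((\<lambda>x. (t - x) powr (\<alpha> - 1) * (x - a) ^ k) has_integral 0) {a..t}"
    using True by (intro has_integral_negligible[OF negligible_sing[of t]]) auto
  thus ?thesis using True by simp
next
  case False
  define s where "s = t - a"
  have s: "s > 0" using False assms by (simp add: s_def)
  have "((\<lambda>u. u powr (real (k + 1) - 1) * (1 - u) powr (\<alpha> - 1)) has_integral
          Beta (real (k + 1)) \<alpha>) (cbox 0 1)"
    using has_integral_Beta_real[of "real (k + 1)" \<alpha>] assms by simp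
  from has_integral_affinity[OF this, of "1 / s" "- a / s"]
  have "((\<lambda>x. ((x - a) / s) powr real k * (1 - (x - a) / s) powr (\<alpha> - 1)) has_integral
          s * Beta (real (k + 1)) \<alpha>) ((\<lambda>x. s *\<^sub>R x + a) ` {0..1})"
    using s by (simp add: diff_divide_distrib)
  moreover have "(\<lambda>x. s *\<^sub>R x + a) ` {0..1} = {a..t}"
    using s image_affinity_atLeastAtMost[of s a 0 1] by (simp add: s_def)
  ultimately have "((\<lambda>x. ((x - a) / s) powr real k * (1 - (x - a) / s) powr (\<alpha> - 1)) has_integral
          s * Beta (real (k + 1)) \<alpha>) {a..t}"
    by simp
  hence "((\<lambda>x. s powr (\<alpha> - 1 + real k) *
            (((x - a) / s) powr real k * (1 - (x - a) / s) powr (\<alpha> - 1))) has_integral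
          s powr (\<alpha> - 1 + real k) * (s * Beta (real (k + 1)) \<alpha>)) {a..t}"
    by (rule has_integral_mult_right)
  moreover have "s powr (\<alpha> - 1 + real k) * (s * Beta (real (k + 1)) \<alpha>) =
      Gamma \<alpha> * fact k / Gamma (\<alpha> + of_nat k + 1) * (t - a) powr (\<alpha> + of_nat k)"
  proof -
    have "s powr (\<alpha> - 1 + real k) * s = s powr (\<alpha> + real k)"
      using s powr_add[of s "\<alpha> - 1 + real k" 1] by simp
    moreover have "Beta (real (k + 1)) \<alpha> = fact k * Gamma \<alpha> / Gamma (\<alpha> + real k + 1)"
      using Gamma_fact[of k, where ?'a = real] by (simp add: Beta_def add_ac)
    ultimately show ?thesis
      by (metis (no_types, opaque_lifting) mult.assoc mult.commute s_def times_divide_eq_right)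
  qed
  ultimately have I: "((\<lambda>x. s powr (\<alpha> - 1 + real k) *
            (((x - a) / s) powr real k * (1 - (x - a) / s) powr (\<alpha> - 1))) has_integral
          Gamma \<alpha> * fact k / Gamma (\<alpha> + of_nat k + 1) * (t - a) powr (\<alpha> + of_nat k)) {a..t}"
    by simp
  show ?thesis
  \<comment> \<open>For \<open>k = 0\<close> the integrands differ at \<open>x = a\<close>, since \<open>0 powr 0 = 0\<close> but \<open>0 ^ 0 = 1\<close>.\<close>
  proof (rule has_integral_spike[OF negligible_finite[of "{a}"] _ I])
    fix x assume "x \<in> {a..t} - {a}"
    hence x: "a < x" "x \<le> t" by auto
    have "1 - (x - a) / s = (t - x) / s"
      using s by (simp add: s_def field_simps)
    thus "(t - x) powr (\<alpha> - 1) * (x - a) ^ k = s powr (\<alpha> - 1 + real k) *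
            (((x - a) / s) powr real k * (1 - (x - a) / s) powr (\<alpha> - 1))"
      using x s by (simp add: powr_divide powr_add powr_realpow)
  qed simp
qed

lemma RL_power_series:
  fixes g :: "real \<Rightarrow> real" and c :: "nat \<Rightarrow> real"
  assumes "0 < \<alpha>" "a \<le> t"
    and c: "summable (\<lambda>k. \<bar>c k\<bar> * (t - a) ^ k)"
    and g: "\<And>x. x \<in> {a..t} \<Longrightarrow> (\<lambda>k. c k * (x - a) ^ k) sums g x"
  shows "RL_integrable a \<alpha> g t"
    and "(\<lambda>k. c k * fact k * (t - a) powr (\<alpha> + of_nat k) / Gamma (\<alpha> + of_nat k + 1))
           sums RL_integral a \<alpha> g t"
proof -
  have kernel: "set_integrable lebesgue {a..t} (\<lambda>x. (t - x) powr (\<alpha> - 1))"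
    using RL_kernel_monomial_integral[OF assms(1,2), of 0]
    by (intro nonnegative_absolutely_integrable_1) (auto simp: integrable_on_def)
  have one: "set_integrable lebesgue {a..t} (\<lambda>x. 1 :: real)"
    by (intro nonnegative_absolutely_integrable_1 integrable_continuous_interval) auto
  show "RL_integrable a \<alpha> g t"
    using weighted_power_series_integral(1)[OF kernel c g]
      weighted_power_series_integral(1)[OF one c g]
    by (simp add: RL_integrable_def)
  have moment: "(LINT x:{a..t}|lebesgue. (t - x) powr (\<alpha> - 1) * (x - a) ^ k) =
      Gamma \<alpha> * fact k / Gamma (\<alpha> + of_nat k + 1) * (t - a) powr (\<alpha> + of_nat k)" for k
    using set_lebesgue_integral_eq_integral(2)[OF weighted_monomial_integrable[OF kernel]]
      RL_kernel_monomial_integral[OF assms(1,2)] by (simp add: integral_unique)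
  have "Gamma \<alpha> \<noteq> 0"
    using Gamma_real_pos[OF assms(1)] by simp
  thus "(\<lambda>k. c k * fact k * (t - a) powr (\<alpha> + of_nat k) / Gamma (\<alpha> + of_nat k + 1))
           sums RL_integral a \<alpha> g t"
    using sums_mult[OF weighted_power_series_integral(2)[OF kernel c g], of "1 / Gamma \<alpha>"]
    unfolding moment RL_integral_def by (simp add: mult_ac)
qed

section \<open>The binomial series of a real power\<close>

lemma Rats_lowest_termsE:
  assumes "\<beta> \<in> \<rat>"
  obtains p q where "q > 0" "coprime p (int q)" "\<beta> = of_int p / of_nat q"
    "lowest_terms \<beta> = (p, q)"
proof -
  from assms obtain r where r: "\<beta> = of_rat r" by (elim Rats_cases)
  obtain p q where pq: "quotient_of r = (p, q)" by force
  have q: "q > 0" "coprime p q" "r = of_int p / of_int q"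
    using pq quotient_of_denom_pos quotient_of_coprime quotient_of_div by blast+
  have "nat q > 0" "coprime p (int (nat q))" "\<beta> = of_int p / of_nat (nat q)"
    using q r by (simp_all add: of_rat_divide)
  with lowest_terms_eqI[OF this] that show ?thesis by blast
qed

text \<open>
  This moves the base point from \<open>1\<close> to \<open>u\<close> of either sign. It is true for negative \<open>u\<close> because
  integer powers and the real root function are multiplicative on all of the real line, and
  because the real logarithm \<^const>\<open>ln\<close> satisfies \<open>ln (-x) = ln x\<close>.
\<close>

lemma rpow_mult_pos:
  assumes "s > 0" "u \<noteq> 0"
  shows "rpow (u * s) \<beta> = rpow u \<beta> * s powr \<beta>"
proof -
  have "rpow (u * s) \<beta> = rpow u \<beta> * rpow s \<beta>"
    using assms unfolding rpow_def
    by (auto simp: power_int_mult_distrib real_root_mult ln_mult ring_distribs exp_add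
             split: prod.split)
  thus ?thesis using assms by (simp add: rpow_pos)
qed

text \<open>
  For a negative base the domain condition is essential: it forces \<open>\<beta>\<close> to be an integer or a
  fraction \<open>p/q\<close> with \<open>p\<close> even, hence \<open>q\<close> odd, and only for odd \<open>q\<close> is the \<open>q\<close>-th power of the
  \<open>q\<close>-th root of a negative number that number again.
\<close>

lemma rpow_diff_nat:
  assumes "a \<in> power_domain d \<beta>" "a \<noteq> d"
  shows "rpow (a - d) (\<beta> - of_nat k) = rpow (a - d) \<beta> / (a - d) ^ k"
proof (cases "a > d")
  case True
  thus ?thesis by (simp add: rpow_pos powr_diff powr_realpow)
next
  case False
  show ?thesis
  proof (cases "\<beta> \<in> \<int>")
    case True
    then obtain n where "\<beta> = of_int n" by (elim Ints_cases)
    thus ?thesis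
      using rpow_of_int[of "a - d" "n - int k"] assms
      by (simp add: rpow_of_int power_int_diff)
  next
    case nint: False
    have "\<beta> \<in> \<rat>"
      using assms False nint by (auto simp: power_domain_def split: if_splits)
    then obtain p q where pq: "q > 0" "coprime p (int q)" "\<beta> = of_int p / of_nat q"
      "lowest_terms \<beta> = (p, q)" by (rule Rats_lowest_termsE)
    have "even p"
      using assms False nint \<open>\<beta> \<in> \<rat>\<close> pq(4) by (auto simp: power_domain_def split: if_splits)
    hence "odd q"
      using pq(2) by (metis coprime_common_divisor even_of_nat odd_one)
    hence "root q (a - d) ^ (k * q) = (a - d) ^ k"
      by (simp add: mult.commute[of k] power_mult odd_real_root_pow)
    moreover have "root q (a - d) powi (int k * int q) = root q (a - d) ^ (k * q)"
      by (metis of_nat_mult power_int_of_nat)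
    ultimately show ?thesis
      using rpow_diff_of_nat[OF pq(1-3) nint, of "a - d" k]
        rpow_diff_of_nat[OF pq(1-3) nint, of "a - d" 0] pq(1) assms(2)
      by (simp add: power_int_diff)
  qed
qed

lemma rpow_binomial_series:
  assumes "a \<in> power_domain d \<beta>" "\<bar>x - a\<bar> < \<bar>a - d\<bar>"
  shows "(\<lambda>k. (\<beta> gchoose k) * rpow (a - d) (\<beta> - of_nat k) * (x - a) ^ k) sums rpow (x - d) \<beta>"
proof -
  define z where "z = (x - a) / (a - d)"
  have ad: "a \<noteq> d" using assms by auto
  have z: "\<bar>z\<bar> < 1" using assms ad by (simp add: z_def)
  have "x - d = (a - d) * (1 + z)"
    using ad by (simp add: z_def field_simps)
  hence "rpow (x - d) \<beta> = rpow (a - d) \<beta> * (1 + z) powr \<beta>"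
    using z ad by (simp add: rpow_mult_pos)
  moreover have "rpow (a - d) \<beta> * ((\<beta> gchoose k) * z ^ k) =
      (\<beta> gchoose k) * rpow (a - d) (\<beta> - of_nat k) * (x - a) ^ k" for k
    using assms ad by (simp add: rpow_diff_nat z_def power_divide)
  ultimately show ?thesis
    using sums_mult[OF gen_binomial_real[OF z, of \<beta>], of "rpow (a - d) \<beta>"] by (simp only:)
qed

section \<open>The fractional integral of a real power\<close>

lemma Gamma_ratio_eq_gchoose:
  "Gamma_ratio (\<beta> + 1) (\<beta> - of_nat k + 1) = (\<beta> gchoose k) * fact k"
  unfolding Gamma_ratio_eq_prod gbinomial_prod_rev by (simp add: atLeast0LessThan)

lemma RL_rpow_series:
  assumes "0 < \<alpha>" "a \<in> power_domain d \<beta>" "a \<le> t" "t - a < \<bar>a - d\<bar>"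
  shows "RL_integrable a \<alpha> (\<lambda>x. rpow (x - d) \<beta>) t"
    and "(\<lambda>k. Gamma_ratio (\<beta> + 1) (\<beta> - of_nat k + 1) * rpow (a - d) (\<beta> - of_nat k)
                * (t - a) powr (\<alpha> + of_nat k) / Gamma (\<alpha> + of_nat k + 1))
           sums RL_integral a \<alpha> (\<lambda>x. rpow (x - d) \<beta>) t"
proof -
  define c where "c k = (\<beta> gchoose k) * rpow (a - d) (\<beta> - of_nat k)" for k
  \<comment> \<open>Convergence at a point strictly beyond \<open>t\<close>, but still inside the disc of convergence, gives
    absolute convergence at \<open>t\<close>.\<close>
  obtain r where r: "t - a < r" "r < \<bar>a - d\<bar>"
    using dense assms(4) by blast
  have "summable (\<lambda>k. c k * r ^ k)"
    using rpow_binomial_series[OF assms(2), of "a + r"] r assms(3)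
    by (auto simp: c_def sums_iff)
  hence "summable (\<lambda>k. norm (c k * (t - a) ^ k))"
    using r assms(3) by (intro powser_insidea[where x = r]) auto
  hence c: "summable (\<lambda>k. \<bar>c k\<bar> * (t - a) ^ k)"
    using assms(3) by (simp add: abs_mult)
  have g: "(\<lambda>k. c k * (x - a) ^ k) sums rpow (x - d) \<beta>" if "x \<in> {a..t}" for x
    using rpow_binomial_series[OF assms(2), of x] that assms(4) by (simp add: c_def)
  show "RL_integrable a \<alpha> (\<lambda>x. rpow (x - d) \<beta>) t"
    by (rule RL_power_series(1)[OF assms(1,3) c g])
  show "(\<lambda>k. Gamma_ratio (\<beta> + 1) (\<beta> - of_nat k + 1) * rpow (a - d) (\<beta> - of_nat k)
                * (t - a) powr (\<alpha> + of_nat k) / Gamma (\<alpha> + of_nat k + 1))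
           sums RL_integral a \<alpha> (\<lambda>x. rpow (x - d) \<beta>) t"
    using RL_power_series(2)[OF assms(1,3) c g]
    by (simp add: c_def Gamma_ratio_eq_gchoose mult_ac)
qed

text \<open>
  For a natural exponent the finite binomial theorem replaces the binomial series, which
  removes the bound on \<open>t\<close> and admits \<open>a = d\<close>.
\<close>

lemma RL_monomial:
  assumes "0 < \<alpha>" "a \<le> t"
  shows "RL_integrable a \<alpha> (\<lambda>x. rpow (x - d) (of_nat m)) t"
    and "RL_integral a \<alpha> (\<lambda>x. rpow (x - d) (of_nat m)) t =
           (\<Sum>k = 0..m. Gamma (of_nat m + 1) * (a - d) ^ (m - k) * (t - a) powr (\<alpha> + of_nat k)
              / (Gamma (of_nat m - of_nat k + 1) * Gamma (\<alpha> + of_nat k + 1)))"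
proof -
  define c where "c k = of_nat (m choose k) * (a - d) ^ (m - k)" for k
  have c0: "c k = 0" if "k \<notin> {0..m}" for k
    using that by (simp add: c_def binomial_eq_0)
  have c: "summable (\<lambda>k. \<bar>c k\<bar> * (t - a) ^ k)"
    by (rule summable_finite[of "{0..m}"]) (auto simp: c0)
  have g: "(\<lambda>k. c k * (x - a) ^ k) sums rpow (x - d) (of_nat m)" for x
  proof -
    have "rpow (x - d) (of_nat m) = ((x - a) + (a - d)) ^ m"
      by (simp add: rpow_of_nat)
    also have "\<dots> = (\<Sum>k\<in>{0..m}. c k * (x - a) ^ k)"
      unfolding binomial_ring by (intro sum.cong) (auto simp: c_def)
    finally show ?thesis
      using sums_finite[of "{0..m}" "\<lambda>k. c k * (x - a) ^ k"] c0 by auto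
  qed
  show "RL_integrable a \<alpha> (\<lambda>x. rpow (x - d) (of_nat m)) t"
    by (rule RL_power_series(1)[OF assms c g])
  let ?s = "\<lambda>k. c k * fact k * (t - a) powr (\<alpha> + of_nat k) / Gamma (\<alpha> + of_nat k + 1)"
  have "RL_integral a \<alpha> (\<lambda>x. rpow (x - d) (of_nat m)) t = (\<Sum>k = 0..m. ?s k)"
    by (rule sums_unique2[OF RL_power_series(2)[OF assms c g] sums_finite]) (auto simp: c0)
  also have "?s k = Gamma (of_nat m + 1) * (a - d) ^ (m - k) * (t - a) powr (\<alpha> + of_nat k)
              / (Gamma (of_nat m - of_nat k + 1) * Gamma (\<alpha> + of_nat k + 1))" if "k \<le> m" for k
  proof -
    have "Gamma (of_nat m + 1) = (fact m :: real)"
      "Gamma (of_nat m - of_nat k + 1) = (fact (m - k) :: real)"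
      using Gamma_fact[of m, where ?'a = real] Gamma_fact[of "m - k", where ?'a = real] that
      by (simp_all add: add_ac of_nat_diff)
    thus ?thesis
      using that by (simp add: c_def binomial_fact)
  qed
  hence "(\<Sum>k = 0..m. ?s k) =
           (\<Sum>k = 0..m. Gamma (of_nat m + 1) * (a - d) ^ (m - k) * (t - a) powr (\<alpha> + of_nat k)
              / (Gamma (of_nat m - of_nat k + 1) * Gamma (\<alpha> + of_nat k + 1)))"
    by (intro sum.cong) auto
  finally show "RL_integral a \<alpha> (\<lambda>x. rpow (x - d) (of_nat m)) t =
           (\<Sum>k = 0..m. Gamma (of_nat m + 1) * (a - d) ^ (m - k) * (t - a) powr (\<alpha> + of_nat k)
              / (Gamma (of_nat m - of_nat k + 1) * Gamma (\<alpha> + of_nat k + 1)))" .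
qed

text \<open>
  The coefficient follows from \<open>(-m) (-m - 1) \<cdots> (-m - k + 1) = (-1)\<^bsup>k\<^esup> m (m + 1) \<cdots> (m + k - 1)\<close>,
  a rising factorial, which is the quotient \<open>\<Gamma>(m + k) / \<Gamma>(m)\<close>.
\<close>

lemma RL_negative_integer_power_series:
  assumes "0 < \<alpha>" "m \<ge> 1" "a \<le> t" "t - a < \<bar>a - d\<bar>"
  shows "(\<lambda>k. (-1) ^ k * Gamma (of_nat (m + k)) * (a - d) powi (- int (m + k))
                * (t - a) powr (\<alpha> + of_nat k) / (Gamma (of_nat m) * Gamma (\<alpha> + of_nat k + 1)))
           sums RL_integral a \<alpha> (\<lambda>x. rpow (x - d) (- of_nat m)) t"
proof -
  have dom: "a \<in> power_domain d (- of_nat m)"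
    using assms by (auto simp: power_domain_def)
  have "Gamma_ratio (- of_nat m + 1) (- of_nat m - of_nat k + 1) =
          (-1) ^ k * Gamma (of_nat (m + k)) / Gamma (of_nat m)" for k
  proof -
    have "of_nat m \<notin> (\<int>\<^sub>\<le>\<^sub>0 :: real set)"
      using assms(2) by (auto elim!: nonpos_Ints_cases')
    thus ?thesis
      using pochhammer_Gamma[of "of_nat m :: real" k]
      unfolding Gamma_ratio_eq_gchoose gbinomial_pochhammer by simp
  qed
  moreover have "rpow (a - d) (- of_nat m - of_nat k) = (a - d) powi (- int (m + k))" for k
  proof -
    have "- of_nat m - of_nat k = real_of_int (- int (m + k))" by simp
    thus ?thesis by (simp only: rpow_of_int)
  qed
  ultimately show ?thesis
    using RL_rpow_series(2)[OF assms(1) dom assms(3,4)] by simp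
qed

theorem theorem3:
  fixes \<alpha> d \<beta> :: real and \<Omega> :: "real set"
  assumes "0 < \<alpha>" "\<alpha> < 1" "is_interval \<Omega>" "\<Omega> \<subseteq> power_domain d \<beta>"
  shows
    "(\<forall>a \<epsilon>. a \<in> \<Omega> \<and> \<epsilon> = \<bar>d - a\<bar> \<and> \<epsilon> > 0 \<longrightarrow>
        (\<forall>t \<in> \<Omega> \<inter> {a..<a + \<epsilon> / 2}.
           RL_integrable a \<alpha> (\<lambda>x. rpow (x - d) \<beta>) t \<and>
           (\<lambda>k. Gamma_ratio (\<beta> + 1) (\<beta> - of_nat k + 1) * rpow (a - d) (\<beta> - of_nat k)
                  * (t - a) powr (\<alpha> + of_nat k) / Gamma (\<alpha> + of_nat k + 1))
             sums RL_integral a \<alpha> (\<lambda>x. rpow (x - d) \<beta>) t)) \<and>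
     (\<forall>\<epsilon> d'. \<epsilon> > 0 \<and> d' = d + \<epsilon> \<and> d' \<in> \<Omega> \<longrightarrow>
        (\<forall>t \<in> \<Omega> \<inter> {d'..<d' + \<epsilon>}.
           RL_integrable d' \<alpha> (\<lambda>x. rpow (x - d) \<beta>) t \<and>
           (\<lambda>k. Gamma_ratio (\<beta> + 1) (\<beta> - of_nat k + 1) * rpow \<epsilon> (\<beta> - of_nat k)
                  * (t - d') powr (\<alpha> + of_nat k) / Gamma (\<alpha> + of_nat k + 1))
             sums RL_integral d' \<alpha> (\<lambda>x. rpow (x - d) \<beta>) t)) \<and>
     (\<forall>m :: nat. \<beta> = of_nat m \<longrightarrow>
        (\<forall>a t. a \<le> t \<longrightarrow>
           RL_integrable a \<alpha> (\<lambda>x. rpow (x - d) \<beta>) t \<and>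
           RL_integral a \<alpha> (\<lambda>x. rpow (x - d) \<beta>) t =
             (\<Sum>k = 0..m. Gamma (of_nat m + 1) * (a - d) ^ (m - k) * (t - a) powr (\<alpha> + of_nat k)
                / (Gamma (of_nat m - of_nat k + 1) * Gamma (\<alpha> + of_nat k + 1))))) \<and>
     (\<forall>m :: nat. m \<ge> 1 \<and> \<beta> = - of_nat m \<longrightarrow>
        (\<forall>a \<epsilon>. a \<in> \<Omega> \<and> \<epsilon> = \<bar>d - a\<bar> \<and> \<epsilon> > 0 \<longrightarrow>
           (\<forall>t \<in> \<Omega> \<inter> {a..<a + \<epsilon> / 2}.
              RL_integrable a \<alpha> (\<lambda>x. rpow (x - d) \<beta>) t \<and>
              (\<lambda>k. (-1) ^ k * Gamma (of_nat (m + k)) * (a - d) powi (- int (m + k))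
                     * (t - a) powr (\<alpha> + of_nat k)
                     / (Gamma (of_nat m) * Gamma (\<alpha> + of_nat k + 1)))
                sums RL_integral a \<alpha> (\<lambda>x. rpow (x - d) \<beta>) t)) \<and>
        (\<forall>\<epsilon> d'. \<epsilon> > 0 \<and> d' = d + \<epsilon> \<and> d' \<in> \<Omega> \<longrightarrow>
           (\<forall>t \<in> \<Omega> \<inter> {d'..<d' + \<epsilon>}.
              RL_integrable d' \<alpha> (\<lambda>x. rpow (x - d) \<beta>) t \<and>
              (\<lambda>k. (-1) ^ k * Gamma (of_nat (m + k)) * \<epsilon> powi (- int (m + k))
                     * (t - d') powr (\<alpha> + of_nat k)
                     / (Gamma (of_nat m) * Gamma (\<alpha> + of_nat k + 1)))
                sums RL_integral d' \<alpha> (\<lambda>x. rpow (x - d) \<beta>) t)))"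
proof -
  have part: "RL_integrable a \<alpha> (\<lambda>x. rpow (x - d) \<beta>) t \<and>
      (\<lambda>k. Gamma_ratio (\<beta> + 1) (\<beta> - of_nat k + 1) * rpow (a - d) (\<beta> - of_nat k)
             * (t - a) powr (\<alpha> + of_nat k) / Gamma (\<alpha> + of_nat k + 1))
        sums RL_integral a \<alpha> (\<lambda>x. rpow (x - d) \<beta>) t"
    if "a \<in> \<Omega>" "a \<le> t" "t - a < \<bar>a - d\<bar>" for a t
    using RL_rpow_series[OF assms(1) _ that(2,3)] that(1) assms(4) by blast
  have neg_part: "RL_integrable a \<alpha> (\<lambda>x. rpow (x - d) \<beta>) t \<and>
      (\<lambda>k. (-1) ^ k * Gamma (of_nat (m + k)) * (a - d) powi (- int (m + k))
             * (t - a) powr (\<alpha> + of_nat k) / (Gamma (of_nat m) * Gamma (\<alpha> + of_nat k + 1)))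
        sums RL_integral a \<alpha> (\<lambda>x. rpow (x - d) \<beta>) t"
    if "m \<ge> 1" "\<beta> = - of_nat m" "a \<in> \<Omega>" "a \<le> t" "t - a < \<bar>a - d\<bar>" for m a t
    using part[OF that(3-5)] RL_negative_integer_power_series[OF assms(1) that(1,4,5)]
    unfolding that(2) by blast
  show ?thesis
  \<comment> \<open>Only conjunctions of quantified parts are split, so that each claim of integrability stays
    together with the value of the integral.\<close>
  proof (intro conjI[where P = "\<forall>a \<epsilon>. _ a \<epsilon>"] conjI[where P = "\<forall>m. _ m"] allI impI ballI;
         (elim conjE IntE)?)
    fix a \<epsilon> t :: real
    assume "a \<in> \<Omega>" "\<epsilon> = \<bar>d - a\<bar>" "\<epsilon> > 0" "t \<in> {a..<a + \<epsilon> / 2}"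
    moreover from this have "a \<le> t" "t - a < \<bar>a - d\<bar>"
      unfolding atLeastLessThan_iff by linarith+
    ultimately show "RL_integrable a \<alpha> (\<lambda>x. rpow (x - d) \<beta>) t \<and>
      (\<lambda>k. Gamma_ratio (\<beta> + 1) (\<beta> - of_nat k + 1) * rpow (a - d) (\<beta> - of_nat k)
             * (t - a) powr (\<alpha> + of_nat k) / Gamma (\<alpha> + of_nat k + 1))
        sums RL_integral a \<alpha> (\<lambda>x. rpow (x - d) \<beta>) t"
      by (intro part)
  next
    fix \<epsilon> d' t :: real
    assume "\<epsilon> > 0" "d' = d + \<epsilon>" "d' \<in> \<Omega>" "t \<in> {d'..<d' + \<epsilon>}"
    thus "RL_integrable d' \<alpha> (\<lambda>x. rpow (x - d) \<beta>) t \<and>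
      (\<lambda>k. Gamma_ratio (\<beta> + 1) (\<beta> - of_nat k + 1) * rpow \<epsilon> (\<beta> - of_nat k)
             * (t - d') powr (\<alpha> + of_nat k) / Gamma (\<alpha> + of_nat k + 1))
        sums RL_integral d' \<alpha> (\<lambda>x. rpow (x - d) \<beta>) t"
      using part[of d' t] by simp
  next
    fix m :: nat and a t :: real
    assume "\<beta> = of_nat m" "a \<le> t"
    thus "RL_integrable a \<alpha> (\<lambda>x. rpow (x - d) \<beta>) t \<and>
      RL_integral a \<alpha> (\<lambda>x. rpow (x - d) \<beta>) t =
        (\<Sum>k = 0..m. Gamma (of_nat m + 1) * (a - d) ^ (m - k) * (t - a) powr (\<alpha> + of_nat k)
           / (Gamma (of_nat m - of_nat k + 1) * Gamma (\<alpha> + of_nat k + 1)))"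
      using RL_monomial[OF assms(1)] by simp
  next
    fix m :: nat and a \<epsilon> t :: real
    assume "m \<ge> 1" "\<beta> = - of_nat m" "a \<in> \<Omega>" "\<epsilon> = \<bar>d - a\<bar>" "\<epsilon> > 0" "t \<in> {a..<a + \<epsilon> / 2}"
    moreover from this have "a \<le> t" "t - a < \<bar>a - d\<bar>"
      unfolding atLeastLessThan_iff by linarith+
    ultimately show "RL_integrable a \<alpha> (\<lambda>x. rpow (x - d) \<beta>) t \<and>
      (\<lambda>k. (-1) ^ k * Gamma (of_nat (m + k)) * (a - d) powi (- int (m + k))
             * (t - a) powr (\<alpha> + of_nat k) / (Gamma (of_nat m) * Gamma (\<alpha> + of_nat k + 1)))
        sums RL_integral a \<alpha> (\<lambda>x. rpow (x - d) \<beta>) t"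
      by (intro neg_part)
  next
    fix m :: nat and \<epsilon> d' t :: real
    assume "m \<ge> 1" "\<beta> = - of_nat m" "\<epsilon> > 0" "d' = d + \<epsilon>" "d' \<in> \<Omega>" "t \<in> {d'..<d' + \<epsilon>}"
    thus "RL_integrable d' \<alpha> (\<lambda>x. rpow (x - d) \<beta>) t \<and>
      (\<lambda>k. (-1) ^ k * Gamma (of_nat (m + k)) * \<epsilon> powi (- int (m + k))
             * (t - d') powr (\<alpha> + of_nat k) / (Gamma (of_nat m) * Gamma (\<alpha> + of_nat k + 1)))
        sums RL_integral d' \<alpha> (\<lambda>x. rpow (x - d) \<beta>) t"
      using neg_part[of m d' t] by simp
  qed
qed

end
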